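(* Let $\mathcal H$ be a real Hilbert space and $\gamma>0$. Let $f\in C^2(\mathcal H)$ be real-valued with $\inf_{\mathcal H}f>-\infty$, with $\nabla f$ Lipschitz continuous on bounded sets, with $\nabla^2f:\mathcal H\to\mathcal L(\mathcal H)$ bounded on bounded sets and Lipschitz continuous in operator norm on every bounded set, and suppose there is $\kappa\ge0$ with $\langle\nabla^2f(x)u,u\rangle\ge-\kappa\|u\|^2$ for all $x,u\in\mathcal H$. Let $\phi:\mathcal H\to\mathbb R\cup\{+\infty\}$ be proper, lower semicontinuous and convex with $\phi(0)=\min\phi=0$ and $r\mathbb B\subseteq\partial\phi(0)$ for some $r>0$. Fix $x_0\in\mathcal H$, $v_0\in\mathrm{Dom}(\partial\phi)$, and $\bar\beta>0$ with $\bar\beta\kappa<\gamma$. For $0\le\beta\le\bar\beta$ let $(x_\beta^I,v_\beta^I)$ and $(x_\beta^E,v_\beta^E)$ be the global strong solutions, with the same initial data $x(0)=x_0$, $\dot x(0)=v_0$, of respectively $$\ddot x+\gamma\dot x+\partial\phi(\dot x)+\nabla f(x+\beta\dot x)\ni0\quad\text{and}\quad\ddot x+\gamma\dot x+\partial\phi(\dot x)+\beta\nabla^2f(x)\dot x+\nabla f(x)\ni0 .$$ Then for every $T>0$ there exists a constant $C_T>0$, independent of $\beta\in[0,\bar\beta]$, such that $$\sup_{0\le t\le T}\left(\|x_\beta^I(t)-x_\beta^E(t)\|+\|v_\beta^I(t)-v_\beta^E(t)\|\right)\le C_T\beta^2 .$$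
   Context: $\mathbb B$ is the closed unit ball of $\mathcal H$; $\partial\phi$ is the convex subdifferential and $\mathrm{Dom}(\partial\phi)=\{v:\partial\phi(v)\neq\varnothing\}$. For a force $F(x,v)$ (here $\nabla f(x+\beta v)$ or $\nabla f(x)+\beta\nabla^2f(x)v$), a strong solution on $[0,T]$ is a pair $(x,v)$ with $x,v\in W^{1,2}(0,T;\mathcal H)$, $v=\dot x$ a.e., the given initial values, and some $\xi\in L^2(0,T;\mathcal H)$ with $\xi(t)\in\partial\phi(v(t))$ and $\dot v+\gamma v+\xi+F(x,v)=0$ a.e.; a global strong solution is one whose restriction to every $[0,T]$ is strong. Under the stated hypotheses both systems have unique global strong solutions for $0\le\beta\le\bar\beta$. *)

theory Defs
  imports "HOL-Analysis.Analysis"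
begin

text \<open>A real Hilbert space is a type of sort \<open>{real_inner, complete_space}\<close>; no separability is
  assumed, so the Bochner integral of HOL-Analysis (which needs a second countable target) is not
  available.\<close>

subsection \<open>Smooth functions\<close>

definition grad :: "('a::real_inner \<Rightarrow> real) \<Rightarrow> 'a \<Rightarrow> 'a" where
  "grad f x = (THE g. GDERIV f x :> g)"

definition hess :: "('a::real_inner \<Rightarrow> real) \<Rightarrow> 'a \<Rightarrow> 'a \<Rightarrow>\<^sub>L 'a" where
  "hess f x = (THE A. (grad f has_derivative blinfun_apply A) (at x))"

text \<open>Continuity of the Hessian is with respect to the operator norm.\<close>

definition C2_fun :: "('a::real_inner \<Rightarrow> real) \<Rightarrow> bool" where
  "C2_fun f \<longleftrightarrow>
     (\<forall>x. \<exists>g. GDERIV f x :> g) \<and>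
     (\<forall>x. \<exists>A :: 'a \<Rightarrow>\<^sub>L 'a. (grad f has_derivative blinfun_apply A) (at x)) \<and>
     continuous_on UNIV (hess f)"

definition lipschitz_on_bounded :: "('a::metric_space \<Rightarrow> 'b::metric_space) \<Rightarrow> bool" where
  "lipschitz_on_bounded F \<longleftrightarrow> (\<forall>B. bounded B \<longrightarrow> (\<exists>L. L-lipschitz_on B F))"

definition bounded_on_bounded :: "('a::metric_space \<Rightarrow> 'b::metric_space) \<Rightarrow> bool" where
  "bounded_on_bounded F \<longleftrightarrow> (\<forall>B. bounded B \<longrightarrow> bounded (F ` B))"

subsection \<open>Extended-valued convex functions\<close>

definition proper_fun :: "('a \<Rightarrow> ereal) \<Rightarrow> bool" where
  "proper_fun \<phi> \<longleftrightarrow> (\<forall>x. \<phi> x \<noteq> -\<infinity>) \<and> (\<exists>x. \<phi> x \<noteq> \<infinity>)"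

definition lsc_fun :: "('a::topological_space \<Rightarrow> ereal) \<Rightarrow> bool" where
  "lsc_fun \<phi> \<longleftrightarrow> (\<forall>x. \<phi> x \<le> Liminf (at x) \<phi>)"

text \<open>At \<open>t = 0\<close> and \<open>t = 1\<close> the convention \<open>0 * \<infinity> = 0\<close> of \<open>ereal\<close> makes the inequality trivial.\<close>

definition convex_fun :: "('a::real_vector \<Rightarrow> ereal) \<Rightarrow> bool" where
  "convex_fun \<phi> \<longleftrightarrow> (\<forall>x y. \<forall>t\<in>{0..1}.
     \<phi> ((1 - t) *\<^sub>R x + t *\<^sub>R y) \<le> ereal (1 - t) * \<phi> x + ereal t * \<phi> y)"

text \<open>For a proper \<open>\<phi>\<close> this set is empty at every \<open>v\<close> with \<open>\<phi> v = \<infinity>\<close>.\<close>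

definition subdiff :: "('a::real_inner \<Rightarrow> ereal) \<Rightarrow> 'a \<Rightarrow> 'a set" where
  "subdiff \<phi> v = {\<xi>. \<forall>w. \<phi> v + ereal (\<xi> \<bullet> (w - v)) \<le> \<phi> w}"

definition Dom_subdiff :: "('a::real_inner \<Rightarrow> ereal) \<Rightarrow> 'a set" where
  "Dom_subdiff \<phi> = {v. subdiff \<phi> v \<noteq> {}}"

subsection \<open>Vector-valued Lebesgue and Sobolev spaces\<close>

text \<open>Strong (Bochner) measurability: almost everywhere limit of simple functions.\<close>

definition strongly_measurable :: "'s measure \<Rightarrow> ('s \<Rightarrow> 'a::real_normed_vector) \<Rightarrow> bool" where
  "strongly_measurable M y \<longleftrightarrow>
     (\<exists>s. (\<forall>n::nat. simple_function M (s n)) \<and> (AE t in M. (\<lambda>n. s n t) \<longlonglongrightarrow> y t))"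

definition L2_on :: "real \<Rightarrow> (real \<Rightarrow> 'a::real_normed_vector) \<Rightarrow> bool" where
  "L2_on T y \<longleftrightarrow> strongly_measurable (lebesgue_on {0..T}) y \<and>
     integrable (lebesgue_on {0..T}) (\<lambda>t. (norm (y t))\<^sup>2)"

text \<open>\<open>W12_deriv T u y\<close>: \<open>u\<close> is the continuous representative of an element of
  $W^{1,2}(0,T;\mathcal{H})$ with weak derivative \<open>y\<close>, that is, \<open>y\<close> is in \<open>L\<^sup>2\<close> and
  $u(t) = u(0) + \int_0^t y$ on \<open>[0,T]\<close>. An \<open>L\<^sup>2\<close> function on \<open>[0,T]\<close> is Bochner integrable, and for
  Bochner integrable functions the Henstock--Kurzweil integral used here exists and equals the
  Bochner integral.\<close>

definition W12_deriv :: "real \<Rightarrow> (real \<Rightarrow> 'a::real_normed_vector) \<Rightarrow> (real \<Rightarrow> 'a) \<Rightarrow> bool" where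
  "W12_deriv T u y \<longleftrightarrow> L2_on T y \<and> (\<forall>t\<in>{0..T}. (y has_integral (u t - u 0)) {0..t})"

subsection \<open>Strong solutions\<close>

text \<open>\<open>F x v\<close> is the force; \<open>x'\<close> and \<open>v'\<close> are the weak derivatives of \<open>x\<close> and \<open>v\<close>.\<close>

definition strong_solution ::
  "real \<Rightarrow> ('a::real_inner \<Rightarrow> ereal) \<Rightarrow> ('a \<Rightarrow> 'a \<Rightarrow> 'a) \<Rightarrow> 'a \<Rightarrow> 'a \<Rightarrow> real \<Rightarrow>
   (real \<Rightarrow> 'a) \<Rightarrow> (real \<Rightarrow> 'a) \<Rightarrow> bool" where
  "strong_solution \<gamma> \<phi> F x\<^sub>0 v\<^sub>0 T x v \<longleftrightarrow>
     x 0 = x\<^sub>0 \<and> v 0 = v\<^sub>0 \<and>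
     (\<exists>x' v' \<xi>. W12_deriv T x x' \<and> W12_deriv T v v' \<and> L2_on T \<xi> \<and>
        (AE t in lebesgue_on {0..T}. v t = x' t) \<and>
        (AE t in lebesgue_on {0..T}. \<xi> t \<in> subdiff \<phi> (v t)) \<and>
        (AE t in lebesgue_on {0..T}. v' t + \<gamma> *\<^sub>R v t + \<xi> t + F (x t) (v t) = 0))"

definition global_strong_solution ::
  "real \<Rightarrow> ('a::real_inner \<Rightarrow> ereal) \<Rightarrow> ('a \<Rightarrow> 'a \<Rightarrow> 'a) \<Rightarrow> 'a \<Rightarrow> 'a \<Rightarrow>
   (real \<Rightarrow> 'a) \<Rightarrow> (real \<Rightarrow> 'a) \<Rightarrow> bool" where
  "global_strong_solution \<gamma> \<phi> F x\<^sub>0 v\<^sub>0 x v \<longleftrightarrow>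
     (\<forall>T>0. strong_solution \<gamma> \<phi> F x\<^sub>0 v\<^sub>0 T x v)"

definition force_I :: "('a::real_inner \<Rightarrow> real) \<Rightarrow> real \<Rightarrow> 'a \<Rightarrow> 'a \<Rightarrow> 'a" where
  "force_I f \<beta> x v = grad f (x + \<beta> *\<^sub>R v)"

definition force_E :: "('a::real_inner \<Rightarrow> real) \<Rightarrow> real \<Rightarrow> 'a \<Rightarrow> 'a \<Rightarrow> 'a" where
  "force_E f \<beta> x v = grad f x + \<beta> *\<^sub>R blinfun_apply (hess f x) v"

end

theory Submission
  imports Defs
begin

text \<open>The energy $\frac12\|v\|^2+f(x)$ is nonincreasing along both systems: the subgradient term
  has a sign, and the lower Hessian bound gives
  $\langle\nabla f(x+\beta v)-\nabla f(x),v\rangle\ge-\beta\kappa\|v\|^2\ge-\gamma\|v\|^2$ (and the same for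
  $\beta\nabla^2f(x)v$), so the damping absorbs the force perturbation. Hence both solutions stay, uniformly
  in \<open>\<beta>\<close>, in one ball. There the two forces at the same state differ by a Taylor remainder
  of order \<open>\<beta>\<^sup>2\<close>, and monotonicity of the subdifferential together with Gronwall's inequality for
  $\|x^I-x^E\|^2+\|v^I-v^E\|^2$ transfers this to the solutions.\<close>

section \<open>Indefinite integrals of Hilbert-space-valued functions\<close>

text \<open>The integral half of \<open>W12_deriv\<close>, without square integrability. It passes
  to differences and to almost everywhere equal derivatives without any measurability
  argument.\<close>

definition weak_primitive :: "real \<Rightarrow> (real \<Rightarrow> 'a::real_normed_vector) \<Rightarrow> (real \<Rightarrow> 'a) \<Rightarrow> bool" where
  "weak_primitive T u y \<longleftrightarrow> (\<forall>t\<in>{0..T}. (y has_integral (u t - u 0)) {0..t})"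

lemma has_integral_le_spike:
  fixes f g :: "real \<Rightarrow> real"
  assumes f: "(f has_integral i) S" and g: "(g has_integral j) S"
    and N: "negligible N" and le: "\<And>x. x \<in> S - N \<Longrightarrow> f x \<le> g x"
  shows "i \<le> j"
proof -
  have "((\<lambda>x. if x \<in> N then g x else f x) has_integral i) S"
    by (rule has_integral_spike[OF N _ f]) auto
  from has_integral_le[OF this g] le show ?thesis by auto
qed

lemma AE_lebesgue_on_negligible:
  fixes a b :: real
  assumes "AE t in lebesgue_on {a..b}. P t"
  shows "\<exists>N. negligible N \<and> (\<forall>t\<in>{a..b} - N. P t)"
proof -
  have "AE t in lebesgue. t \<in> {a..b} \<longrightarrow> P t"
    using assms by (subst (asm) AE_restrict_space_iff) auto
  then obtain N where "N \<in> null_sets lebesgue" "{t \<in> space lebesgue. \<not> (t \<in> {a..b} \<longrightarrow> P t)} \<subseteq> N"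
    by (auto simp: eventually_ae_filter)
  then show ?thesis
    by (intro exI[of _ N]) (auto simp: negligible_iff_null_sets)
qed

lemma weak_primitive_diff:
  assumes "weak_primitive T u y" "weak_primitive T v z"
  shows "weak_primitive T (\<lambda>t. u t - v t) (\<lambda>t. y t - z t)"
  unfolding weak_primitive_def
proof
  fix t assume "t \<in> {0..T}"
  with assms have "((\<lambda>t. y t - z t) has_integral (u t - u 0) - (v t - v 0)) {0..t}"
    unfolding weak_primitive_def by (intro has_integral_diff) auto
  then show "((\<lambda>t. y t - z t) has_integral (u t - v t - (u 0 - v 0))) {0..t}"
    by (simp add: algebra_simps)
qed

lemma weak_primitive_spike:
  assumes "weak_primitive T u y" "negligible N" "\<And>t. t \<in> {0..T} - N \<Longrightarrow> z t = y t"
  shows "weak_primitive T u z"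
  unfolding weak_primitive_def
proof
  fix t assume t: "t \<in> {0..T}"
  show "(z has_integral u t - u 0) {0..t}"
    by (rule has_integral_spike[OF assms(2)]) (use assms t in \<open>auto simp: weak_primitive_def\<close>)
qed

text \<open>The splitting of vector-valued integrals in the library requires the class \<open>banach\<close>, which a
  type of sort \<open>{real_inner, complete_space}\<close> does not belong to. Testing with a fixed vector
  reduces everything to real-valued integrals.\<close>

lemma weak_primitive_inner:
  fixes y :: "real \<Rightarrow> 'a::real_inner"
  assumes "weak_primitive T u y" "0 \<le> s" "s \<le> t" "t \<le> T"
  shows "((\<lambda>\<tau>. y \<tau> \<bullet> e) has_integral (u t - u s) \<bullet> e) {s..t}"
proof -
  have I: "((\<lambda>\<tau>. y \<tau> \<bullet> e) has_integral (u \<sigma> - u 0) \<bullet> e) {0..\<sigma>}" if "\<sigma> \<in> {0..T}" for \<sigma>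
    using has_integral_linear[of y "u \<sigma> - u 0" "{0..\<sigma>}" "\<lambda>a. a \<bullet> e"] that assms(1)
    by (simp add: weak_primitive_def bounded_linear_inner_left o_def)
  have t: "((\<lambda>\<tau>. y \<tau> \<bullet> e) has_integral (u t - u 0) \<bullet> e) {0..t}"
    and s: "((\<lambda>\<tau>. y \<tau> \<bullet> e) has_integral (u s - u 0) \<bullet> e) {0..s}"
    using I assms by auto
  have "(\<lambda>\<tau>. y \<tau> \<bullet> e) integrable_on {s..t}"
    using integrable_on_subinterval[OF has_integral_integrable[OF t]] assms by auto
  then obtain j where j: "((\<lambda>\<tau>. y \<tau> \<bullet> e) has_integral j) {s..t}" by blast
  have "(u s - u 0) \<bullet> e + j = (u t - u 0) \<bullet> e"
    using has_integral_unique[OF has_integral_combine[OF _ _ s j] t] assms by simp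
  then have "j = (u t - u s) \<bullet> e" by (simp add: inner_diff_left)
  with j show ?thesis by simp
qed

text \<open>The vector \<open>e\<close> on the left is tested with itself: its squared norm is the
  integral of \<open>(y \<tau> - a) \<bullet> e\<close>, hence at most \<open>norm e\<close> times
  the integral of \<open>p\<close>, and one factor \<open>norm e\<close> cancels. The choice
  \<open>a = 0\<close> yields continuity, \<open>a = v t\<close> differentiability.\<close>

lemma weak_primitive_increment_le:
  fixes y :: "real \<Rightarrow> 'a::real_inner"
  assumes u: "weak_primitive T u y" and st: "0 \<le> s" "s \<le> t" "t \<le> T"
    and p: "p integrable_on {s..t}" and le: "\<And>\<tau>. \<tau> \<in> {s..t} \<Longrightarrow> norm (y \<tau> - a) \<le> p \<tau>"
  shows "norm (u t - u s - (t - s) *\<^sub>R a) \<le> integral {s..t} p"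
proof -
  define e where "e = u t - u s - (t - s) *\<^sub>R a"
  have "((\<lambda>\<tau>. y \<tau> \<bullet> e - a \<bullet> e) has_integral (u t - u s) \<bullet> e - (t - s) *\<^sub>R (a \<bullet> e)) {s..t}"
    using has_integral_diff[OF weak_primitive_inner[OF u st, of e]
        has_integral_const_real[of "a \<bullet> e" s t]] st by (simp add: algebra_simps)
  moreover have "((\<lambda>\<tau>. p \<tau> * norm e) has_integral integral {s..t} p * norm e) {s..t}"
    using p by (intro has_integral_mult_left) (simp add: integrable_integral)
  moreover have "y \<tau> \<bullet> e - a \<bullet> e \<le> p \<tau> * norm e" if "\<tau> \<in> {s..t}" for \<tau>
    using norm_cauchy_schwarz[of "y \<tau> - a" e] mult_right_mono[OF le[OF that], of "norm e"]
    by (simp add: inner_diff_left)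
  ultimately have "(u t - u s) \<bullet> e - (t - s) *\<^sub>R (a \<bullet> e) \<le> integral {s..t} p * norm e"
    by (rule has_integral_le)
  moreover have "(u t - u s) \<bullet> e - (t - s) *\<^sub>R (a \<bullet> e) = norm e * norm e"
    unfolding e_def by (simp add: inner_diff_left dot_square_norm flip: power2_eq_square)
      (simp add: algebra_simps power2_norm_eq_inner)
  ultimately have "norm e * norm e \<le> integral {s..t} p * norm e" by simp
  \<comment> \<open>Covers the case \<open>e = 0\<close>, in which \<open>norm e\<close> cannot be
    cancelled.\<close>
  moreover have "integral {s..t} p \<ge> 0"
    using le by (intro integral_nonneg p) (meson norm_ge_zero order_trans)
  ultimately show ?thesis
    unfolding e_def[symmetric] by (cases "e = 0") auto
qed

text \<open>Increments of \<open>u\<close> are dominated by those of the indefinite integral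
  \<open>P\<close> of \<open>p\<close>, which is continuous.\<close>

lemma weak_primitive_continuous_on:
  fixes y :: "real \<Rightarrow> 'a::real_inner"
  assumes u: "weak_primitive T u y"
    and p: "p integrable_on {0..T}" and le: "\<And>\<tau>. \<tau> \<in> {0..T} \<Longrightarrow> norm (y \<tau>) \<le> p \<tau>"
  shows "continuous_on {0..T} u"
proof -
  define P where "P = (\<lambda>t. integral {0..t} p)"
  have *: "dist (u t) (u s) \<le> dist (P t) (P s)" if "0 \<le> s" "s \<le> t" "t \<le> T" for s t
  proof -
    have "p integrable_on {s..t}" "p integrable_on {0..t}"
      using integrable_on_subinterval[OF p] that by auto
    then have "norm (u t - u s - (t - s) *\<^sub>R 0) \<le> integral {s..t} p" "integral {s..t} p = P t - P s"
      using weak_primitive_increment_le[OF u, of s t p 0] le that Henstock_Kurzweil_Integration.integral_combine[of 0 s t p]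
      by (auto simp: P_def)
    then show ?thesis by (simp add: dist_norm)
  qed
  then have **: "dist (u t) (u s) \<le> dist (P t) (P s)" if "s \<in> {0..T}" "t \<in> {0..T}" for s t
    using that by (cases "s \<le> t") (force simp: dist_commute)+
  have "continuous_on {0..T} P"
    unfolding P_def by (rule indefinite_integral_continuous_1[OF p])
  then show ?thesis
    unfolding continuous_on_iff using ** by (meson le_less_trans)
qed

text \<open>Near \<open>t\<close> the values of \<open>v\<close> stay within \<open>e\<close> of
  \<open>v t\<close>, so the increment estimate with \<open>a = v t\<close> and the constant bound
  \<open>p = e\<close> is the difference quotient estimate.\<close>

lemma weak_primitive_has_vector_derivative:
  fixes v :: "real \<Rightarrow> 'a::real_inner"
  assumes x: "weak_primitive T x v" and v: "continuous_on {0..T} v" and t: "t \<in> {0..T}"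
  shows "(x has_vector_derivative v t) (at t within {0..T})"
  unfolding has_vector_derivative_def has_derivative_within_alt
proof (intro conjI allI impI)
  show "bounded_linear (\<lambda>h. h *\<^sub>R v t)" by (rule bounded_linear_scaleR_left)
  fix e :: real assume "e > 0"
  then obtain d where d: "d > 0" "\<And>s. s \<in> {0..T} \<Longrightarrow> dist s t < d \<Longrightarrow> dist (v s) (v t) < e"
    using v t unfolding continuous_on_iff by blast
  show "\<exists>d>0. \<forall>s\<in>{0..T}. norm (s - t) < d \<longrightarrow>
      norm (x s - x t - (s - t) *\<^sub>R v t) \<le> e * norm (s - t)"
  proof (intro exI[of _ d] conjI ballI impI d(1))
    fix s assume s: "s \<in> {0..T}" "norm (s - t) < d"
    \<comment> \<open>Using \<open>min\<close> and \<open>max\<close> treats \<open>s\<close> on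
      either side of \<open>t\<close> at once; every time in between is no farther from
      \<open>t\<close> than \<open>s\<close> is.\<close>
    have near: "norm (v \<tau> - v t) \<le> e" if "\<tau> \<in> {min s t..max s t}" for \<tau>
      using d(2)[of \<tau>] that s t by (auto simp: dist_norm min_def max_def split: if_splits)
    have "norm (x (max s t) - x (min s t) - (max s t - min s t) *\<^sub>R v t)
        \<le> integral {min s t..max s t} (\<lambda>_. e)"
      using s t near by (intro weak_primitive_increment_le[OF x]) auto
    then show "norm (x s - x t - (s - t) *\<^sub>R v t) \<le> e * norm (s - t)"
      using norm_minus_commute[of "x s - x t" "(s - t) *\<^sub>R v t"]
      by (auto simp: min_def max_def algebra_simps norm_minus_commute split: if_splits)
  qed
qed

section \<open>Growth of the squared norm along a weak primitive\<close>

text \<open>Sum over \<open>Suc n\<close> equal subintervals: the mesh factors out, the increments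
  of \<open>N\<close> telescope, and what remains is a fixed number divided by \<open>Suc n\<close>,
  which tends to 0.\<close>

lemma increment_le_imp_le:
  fixes h N :: "real \<Rightarrow> real"
  assumes "a \<le> b"
    and le: "\<And>s t. a \<le> s \<Longrightarrow> s \<le> t \<Longrightarrow> t \<le> b \<Longrightarrow> h t - h s \<le> (t - s) * (N t - N s)"
  shows "h b \<le> h a"
proof -
  define L where "L = b - a"
  have bound: "h b - h a \<le> L * (N b - N a) / real (Suc n)" for n
  proof -
    define p where "p = (\<lambda>k. a + L * real k / real (Suc n))"
    have step: "p (Suc k) - p k = L / real (Suc n)" for k
      by (simp add: p_def add_divide_distrib[symmetric] diff_divide_distrib[symmetric] algebra_simps)
    have "h (p (Suc k)) - h (p k) \<le> L / real (Suc n) * (N (p (Suc k)) - N (p k))" if "k < Suc n" for k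
    proof -
      have "L * real (Suc k) / real (Suc n) \<le> L"
        using that assms(1) by (simp add: L_def pos_divide_le_eq mult_left_mono)
      then have "p (Suc k) \<le> b" by (simp add: p_def L_def)
      moreover have "0 \<le> L / real (Suc n)" "a \<le> p k"
        using assms(1) by (auto simp: p_def L_def)
      ultimately have "a \<le> p k" "p k \<le> p (Suc k)" "p (Suc k) \<le> b"
        using step[of k] by auto
      from le[OF this] show ?thesis by (simp only: step)
    qed
    then have "(\<Sum>k<Suc n. h (p (Suc k)) - h (p k)) \<le>
        (\<Sum>k<Suc n. L / real (Suc n) * (N (p (Suc k)) - N (p k)))"
      by (intro sum_mono) auto
    then have "h (p (Suc n)) - h (p 0) \<le> L / real (Suc n) * (N (p (Suc n)) - N (p 0))"
      by (simp only: sum_distrib_left[symmetric] sum_lessThan_telescope[of "\<lambda>k. h (p k)"]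
          sum_lessThan_telescope[of "\<lambda>k. N (p k)"])
    moreover have "p 0 = a" "p (Suc n) = b" by (auto simp: p_def L_def)
    ultimately show ?thesis by simp
  qed
  have "(\<lambda>n. L * (N b - N a) / real (Suc n)) \<longlonglongrightarrow> 0"
    by (rule LIMSEQ_Suc) (rule lim_const_over_n)
  then have "h b - h a \<le> 0"
    by (rule Lim_bounded2) (use bound in auto)
  then show ?thesis by simp
qed

text \<open>Cauchy-Schwarz, obtained by integrating \<open>(p \<tau> - c)\<^sup>2 \<ge> 0\<close>
  with \<open>c\<close> the mean value of \<open>p\<close>.\<close>

lemma integral_power2_le:
  fixes p :: "real \<Rightarrow> real"
  assumes "s \<le> t" "p integrable_on {s..t}" "(\<lambda>\<tau>. (p \<tau>)\<^sup>2) integrable_on {s..t}"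
  shows "(integral {s..t} p)\<^sup>2 \<le> (t - s) * integral {s..t} (\<lambda>\<tau>. (p \<tau>)\<^sup>2)"
proof (cases "s = t")
  case False
  define P where "P = integral {s..t} p"
  define Q where "Q = integral {s..t} (\<lambda>\<tau>. (p \<tau>)\<^sup>2)"
  define c where "c = P / (t - s)"
  have "((\<lambda>\<tau>. (p \<tau>)\<^sup>2 - 2 * c * p \<tau> + c\<^sup>2) has_integral Q - 2 * c * P + (t - s) *\<^sub>R c\<^sup>2) {s..t}"
    using assms has_integral_const_real[of "c\<^sup>2" s t] unfolding P_def Q_def
    by (intro has_integral_add has_integral_diff has_integral_mult_right)
      (auto simp: integrable_integral)
  then have "0 \<le> Q - 2 * c * P + (t - s) *\<^sub>R c\<^sup>2"
    by (rule has_integral_nonneg) (use zero_le_power2[of "p _ - c"] in \<open>auto simp: power2_diff algebra_simps\<close>)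
  moreover have P: "P = c * (t - s)" using False by (simp add: c_def)
  moreover from P have "(t - s) *\<^sub>R c\<^sup>2 = c * P" by (simp add: power2_eq_square)
  ultimately have "c * P \<le> Q" by linarith
  then have "(t - s) * (c * P) \<le> (t - s) * Q" using assms(1) by (intro mult_left_mono) auto
  moreover have "(t - s) * (c * P) = P\<^sup>2" using P by (simp add: power2_eq_square)
  ultimately have "P\<^sup>2 \<le> (t - s) * Q" by simp
  then show ?thesis by (simp add: P_def Q_def)
qed simp

text \<open>On \<open>{s..t}\<close> the increment of $\|u\|^2-2\int q$ is at most $3(\int_s^tp)^2\le3(t-s)\int_s^tp^2$, of
  higher order in the mesh, so no almost everywhere differentiability of \<open>u\<close> is needed.\<close>

lemma norm_power2_weak_primitive_le:
  fixes u y :: "real \<Rightarrow> 'a::real_inner"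
  assumes T: "0 \<le> T" and u: "weak_primitive T u y"
    and p: "p integrable_on {0..T}" and p2: "(\<lambda>t. (p t)\<^sup>2) integrable_on {0..T}"
    and yp: "\<And>t. t \<in> {0..T} \<Longrightarrow> norm (y t) \<le> p t"
    and N: "negligible N" and yq: "\<And>t. t \<in> {0..T} - N \<Longrightarrow> y t \<bullet> u t \<le> q t"
    and q: "q integrable_on {0..T}"
  shows "(norm (u T))\<^sup>2 \<le> (norm (u 0))\<^sup>2 + 2 * integral {0..T} q"
proof -
  define Q where "Q = (\<lambda>t. integral {0..t} q)"
  \<comment> \<open>The factor 3: replacing \<open>u \<tau>\<close> by \<open>u s\<close> in the
    pairing costs \<open>2 * P\<^sup>2\<close>, and the quadratic remainder
    \<open>(norm (u t - u s))\<^sup>2\<close> costs one more \<open>P\<^sup>2\<close>.\<close>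
  define M where "M = (\<lambda>t. 3 * integral {0..t} (\<lambda>t. (p t)\<^sup>2))"
  have "(norm (u t))\<^sup>2 - 2 * Q t - ((norm (u s))\<^sup>2 - 2 * Q s) \<le> (t - s) * (M t - M s)"
    if st: "0 \<le> s" "s \<le> t" "t \<le> T" for s t
  proof -
    define P where "P = integral {s..t} p"
    have int: "f integrable_on {s..t} \<and> integral {s..t} f = integral {0..t} f - integral {0..s} f"
      if "f integrable_on {0..T}" for f :: "real \<Rightarrow> real"
      using integrable_on_subinterval[OF that, of s t] integrable_on_subinterval[OF that, of 0 t]
        st Henstock_Kurzweil_Integration.integral_combine[of 0 s t f] by auto
    have inc: "norm (u \<tau> - u s) \<le> P" if "\<tau> \<in> {s..t}" for \<tau>
    proof -
      have i: "p integrable_on {s..\<tau>}" using integrable_on_subinterval[OF p, of s \<tau>] that st by auto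
      then have "norm (u \<tau> - u s - (\<tau> - s) *\<^sub>R 0) \<le> integral {s..\<tau>} p"
        using that st yp by (intro weak_primitive_increment_le[OF u]) auto
      also have "\<dots> \<le> P" unfolding P_def
      proof (rule integral_subset_le)
        show "\<forall>x\<in>{s..t}. 0 \<le> p x"
        proof
          fix x assume "x \<in> {s..t}"
          with st have "x \<in> {0..T}" by auto
          from order_trans[OF norm_ge_zero yp[OF this]] show "0 \<le> p x" .
        qed
      qed (use that i int[OF p] in auto)
      finally show ?thesis by simp
    qed
    \<comment> \<open>The integral identity pairs \<open>y\<close> with a fixed vector, here
      \<open>u s\<close>, whereas the hypothesis concerns \<open>u \<tau>\<close>; the exchange
      costs at most \<open>p \<tau> * P\<close>.\<close>
    have "y \<tau> \<bullet> u s \<le> q \<tau> + p \<tau> * P" if "\<tau> \<in> {s..t} - N" for \<tau>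
    proof -
      have "y \<tau> \<bullet> u s = y \<tau> \<bullet> u \<tau> + y \<tau> \<bullet> (u s - u \<tau>)" by (simp add: inner_diff_right)
      moreover have "y \<tau> \<bullet> (u s - u \<tau>) \<le> norm (y \<tau>) * norm (u s - u \<tau>)"
        by (rule norm_cauchy_schwarz)
      moreover have "\<dots> \<le> p \<tau> * P"
        using inc[of \<tau>] that st yp[of \<tau>] by (intro mult_mono) (auto simp: norm_minus_commute intro: order_trans[OF norm_ge_zero])
      ultimately show ?thesis using yq[of \<tau>] that st by auto
    qed
    moreover have "((\<lambda>\<tau>. q \<tau> + p \<tau> * P) has_integral integral {s..t} q + P * P) {s..t}"
      unfolding P_def using int[OF p] int[OF q]
      by (intro has_integral_add has_integral_mult_left integrable_integral) auto
    ultimately have "(u t - u s) \<bullet> u s \<le> integral {s..t} q + P * P"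
      using has_integral_le_spike[OF weak_primitive_inner[OF u st, of "u s"] _ N] by blast
    moreover have "(norm (u t))\<^sup>2 - (norm (u s))\<^sup>2 = 2 * ((u t - u s) \<bullet> u s) + (norm (u t - u s))\<^sup>2"
      by (simp add: power2_norm_eq_inner inner_diff_left inner_diff_right inner_commute)
    moreover have "(norm (u t - u s))\<^sup>2 \<le> P\<^sup>2" using inc[of t] st by (intro power_mono) auto
    ultimately have "(norm (u t))\<^sup>2 - (norm (u s))\<^sup>2 \<le> 2 * integral {s..t} q + 3 * P\<^sup>2"
      by (simp add: power2_eq_square)
    also have "3 * P\<^sup>2 \<le> 3 * ((t - s) * integral {s..t} (\<lambda>\<tau>. (p \<tau>)\<^sup>2))"
      unfolding P_def using integral_power2_le[of s t p] st int[OF p] int[OF p2] by simp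
    finally show ?thesis
      using int[OF q] int[OF p2] by (simp add: Q_def M_def algebra_simps)
  qed
  from increment_le_imp_le[OF T this] show ?thesis by (simp add: Q_def)
qed

section \<open>Gronwall's inequality\<close>

text \<open>Integrating factor: for \<open>G\<close> the right-hand side, the shift
  \<open>c / K\<close> in \<open>h\<close> cancels the constant \<open>c\<close> of the derivative
  of \<open>G\<close>. What is left has the sign of \<open>g t - G t\<close>, so \<open>h\<close> is
  nonincreasing.\<close>

lemma gronwall_affine:
  fixes g :: "real \<Rightarrow> real"
  assumes K: "K > 0" and c: "c \<ge> 0" and T: "0 \<le> T" and g: "continuous_on {0..T} g"
    and le: "\<And>t. t \<in> {0..T} \<Longrightarrow> g t \<le> integral {0..t} (\<lambda>s. K * g s + c)"
  shows "g T \<le> c / K * exp (K * T)"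
proof -
  define G where "G = (\<lambda>t. integral {0..t} (\<lambda>s. K * g s + c))"
  define h where "h = (\<lambda>t. exp (- K * t) * (G t + c / K))"
  have dG: "(G has_real_derivative K * g t + c) (at t within {0..T})" if "t \<in> {0..T}" for t
    unfolding G_def has_real_derivative_iff_has_vector_derivative
    by (rule integral_has_vector_derivative) (use that g in \<open>auto intro!: continuous_intros\<close>)
  have dh: "(h has_real_derivative exp (- K * t) * (K * g t - K * G t)) (at t within {0..T})"
    if "t \<in> {0..T}" for t
    unfolding h_def
    by (rule derivative_eq_intros dG that refl | use K in \<open>simp add: field_simps\<close>)+
  have "h T \<le> h 0"
  proof (rule DERIV_nonpos_imp_decreasing_open[OF T])
    fix t assume t: "0 < t" "t < T"
    then have "(h has_real_derivative exp (- K * t) * (K * g t - K * G t)) (at t)"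
      using dh[of t] by (simp add: at_within_Icc_at)
    moreover have "exp (- K * t) * (K * g t - K * G t) \<le> 0"
      using le[of t] t K by (intro mult_nonneg_nonpos) (auto simp: G_def)
    ultimately show "\<exists>y. (h has_real_derivative y) (at t) \<and> y \<le> 0" by blast
  next
    show "continuous_on {0..T} h"
      using dh by (meson DERIV_continuous continuous_on_eq_continuous_within)
  qed
  \<comment> \<open>Here \<open>h 0 = c / K\<close>, as \<open>G 0\<close> is an integral over a
    single point.\<close>
  then have "exp (- K * T) * (G T + c / K) \<le> c / K"
    by (simp add: h_def G_def)
  then have "exp (K * T) * (exp (- K * T) * (G T + c / K)) \<le> exp (K * T) * (c / K)"
    by (rule mult_left_mono) simp
  then have "G T + c / K \<le> c / K * exp (K * T)"
    by (simp add: mult.assoc[symmetric] exp_add[symmetric] mult.commute)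
  moreover have "g T \<le> G T" using le[of T] T by (simp add: G_def)
  moreover have "0 \<le> c / K" using K c by simp
  ultimately show ?thesis by linarith
qed


section \<open>Square-integrable functions\<close>

text \<open>Supplies the real dominating functions \<open>p\<close> of the squared-norm estimate,
  which must be both integrable and square integrable.\<close>

lemma integrable_on_power2_sum:
  fixes a b :: "real \<Rightarrow> real"
  assumes a: "a \<in> borel_measurable (lebesgue_on {0..T})" "integrable (lebesgue_on {0..T}) (\<lambda>t. (a t)\<^sup>2)"
    and b: "b \<in> borel_measurable (lebesgue_on {0..T})" "integrable (lebesgue_on {0..T}) (\<lambda>t. (b t)\<^sup>2)"
  shows "(\<lambda>t. a t + b t) integrable_on {0..T}" "(\<lambda>t. (a t + b t)\<^sup>2) integrable_on {0..T}"
proof -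
  have ab2: "integrable (lebesgue_on {0..T}) (\<lambda>t. (a t + b t)\<^sup>2)"
  proof (rule Bochner_Integration.integrable_bound)
    show "integrable (lebesgue_on {0..T}) (\<lambda>t. 2 * (a t)\<^sup>2 + 2 * (b t)\<^sup>2)"
      using a(2) b(2) by simp
    show "(\<lambda>t. (a t + b t)\<^sup>2) \<in> borel_measurable (lebesgue_on {0..T})"
      using a(1) b(1) by measurable
    have "(a t + b t)\<^sup>2 \<le> 2 * (a t)\<^sup>2 + 2 * (b t)\<^sup>2" for t
      using sum_squares_bound[of "a t" "b t"] by (simp add: power2_sum)
    then show "AE t in lebesgue_on {0..T}. norm ((a t + b t)\<^sup>2) \<le> norm (2 * (a t)\<^sup>2 + 2 * (b t)\<^sup>2)"
      by (simp add: order_trans)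
  qed
  have ab: "integrable (lebesgue_on {0..T}) (\<lambda>t. a t + b t)"
  proof (rule Bochner_Integration.integrable_bound)
    show "integrable (lebesgue_on {0..T}) (\<lambda>t. 1 + (a t + b t)\<^sup>2)"
      using ab2 by (simp add: integrable_const_ivl)
    show "(\<lambda>t. a t + b t) \<in> borel_measurable (lebesgue_on {0..T})"
      using a(1) b(1) by measurable
    \<comment> \<open>Constants are integrable on a bounded interval, so this bound turns square
      integrability into integrability.\<close>
    have "\<bar>c\<bar> \<le> 1 + c\<^sup>2" for c :: real
      using sum_squares_bound[of "\<bar>c\<bar>" 1] by simp
    then show "AE t in lebesgue_on {0..T}. norm (a t + b t) \<le> norm (1 + (a t + b t)\<^sup>2)"
      by simp
  qed
  show "(\<lambda>t. a t + b t) integrable_on {0..T}" "(\<lambda>t. (a t + b t)\<^sup>2) integrable_on {0..T}"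
    using ab ab2 by (auto intro: integrable_on_lebesgue_on)
qed

text \<open>Integrability of the squared norm includes its measurability, and the square root
  recovers the norm.\<close>

lemma L2_on_norm_measurable:
  assumes "L2_on T y"
  shows "(\<lambda>t. norm (y t)) \<in> borel_measurable (lebesgue_on {0..T})"
proof -
  have "(\<lambda>t. (norm (y t))\<^sup>2) \<in> borel_measurable (lebesgue_on {0..T})"
    using assms by (auto simp: L2_on_def)
  then have "(\<lambda>t. sqrt ((norm (y t))\<^sup>2)) \<in> borel_measurable (lebesgue_on {0..T})"
    by measurable
  then show ?thesis by simp
qed

section \<open>Subgradients\<close>

text \<open>The subgradient inequality tested at 0, where \<open>\<phi>\<close> vanishes, excludes
  the value infinity. Inequalities in \<open>ereal\<close> then become real ones.\<close>

lemma subdiff_proper_finite: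
  assumes "proper_fun \<phi>" "\<phi> 0 = 0" "\<xi> \<in> subdiff \<phi> v"
  obtains c where "\<phi> v = ereal c"
proof -
  have "\<phi> v + ereal (\<xi> \<bullet> (0 - v)) \<le> \<phi> 0"
    using assms(3) unfolding subdiff_def by blast
  then have "\<phi> v \<noteq> \<infinity>" using assms(2) by auto
  moreover have "\<phi> v \<noteq> -\<infinity>" using assms(1) by (auto simp: proper_fun_def)
  ultimately show ?thesis using that by (cases "\<phi> v") auto
qed

text \<open>Add the subgradient inequality at \<open>v\<close> tested at \<open>w\<close> and the
  one at \<open>w\<close> tested at \<open>v\<close>; the values of \<open>\<phi>\<close> are finite
  and cancel.\<close>

lemma subdiff_monotone:
  assumes "proper_fun \<phi>" "\<phi> 0 = 0" "\<xi> \<in> subdiff \<phi> v" "\<eta> \<in> subdiff \<phi> w"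
  shows "(\<xi> - \<eta>) \<bullet> (v - w) \<ge> 0"
proof -
  obtain a b where ab: "\<phi> v = ereal a" "\<phi> w = ereal b"
    using subdiff_proper_finite assms by metis
  have "\<phi> v + ereal (\<xi> \<bullet> (w - v)) \<le> \<phi> w" "\<phi> w + ereal (\<eta> \<bullet> (v - w)) \<le> \<phi> v"
    using assms(3,4) by (auto simp: subdiff_def)
  then show ?thesis by (simp add: ab inner_diff_left inner_diff_right)
qed

lemma subdiff_zero_of_min:
  assumes "\<phi> 0 = 0" "\<And>v. \<phi> 0 \<le> \<phi> v"
  shows "0 \<in> subdiff \<phi> 0"
  using assms by (simp add: subdiff_def zero_ereal_def[symmetric])

section \<open>Gradient, Hessian and Taylor estimates\<close>

text \<open>Justifies the definite description in \<open>grad\<close>: two gradients represent the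
  same functional, and testing it with their difference shows them equal.\<close>

lemma C2_fun_gderiv:
  assumes "C2_fun f"
  shows "GDERIV f x :> grad f x"
proof -
  obtain g where g: "GDERIV f x :> g" using assms by (auto simp: C2_fun_def)
  have "h = g" if "GDERIV f x :> h" for h
  proof -
    have "(\<lambda>v. v \<bullet> h) = (\<lambda>v. v \<bullet> g)"
      using has_derivative_unique that g by (auto simp: gderiv_def)
    then have "(h - g) \<bullet> h = (h - g) \<bullet> g" by metis
    then have "(h - g) \<bullet> (h - g) = 0" by (simp add: inner_diff_right)
    then show ?thesis by simp
  qed
  then show ?thesis unfolding grad_def using g by (metis (mono_tags, lifting) theI)
qed

lemma C2_fun_grad_has_derivative:
  assumes "C2_fun f"
  shows "(grad f has_derivative blinfun_apply (hess f x)) (at x)"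
proof -
  obtain A :: "'a \<Rightarrow>\<^sub>L 'a" where A: "(grad f has_derivative blinfun_apply A) (at x)"
    using assms by (auto simp: C2_fun_def)
  have "B = A" if "(grad f has_derivative blinfun_apply B) (at x)" for B :: "'a \<Rightarrow>\<^sub>L 'a"
    using has_derivative_unique[OF that A] by (simp add: blinfun_apply_inject)
  then show ?thesis unfolding hess_def using A by (metis (mono_tags, lifting) theI)
qed

text \<open>Along the line \<open>x + s *\<^sub>R v\<close> the directional derivative becomes
  nondecreasing once \<open>\<kappa> * (norm v)\<^sup>2 * s\<close> is added. This limits the energy
  that the implicit force can feed in beyond \<open>grad f x\<close>.\<close>

lemma grad_increment_inner_ge:
  assumes f: "C2_fun f" and "\<beta> \<ge> 0"
    and hess: "\<And>x u. blinfun_apply (hess f x) u \<bullet> u \<ge> - \<kappa> * (norm u)\<^sup>2"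
  shows "(grad f (x + \<beta> *\<^sub>R v) - grad f x) \<bullet> v \<ge> - (\<beta> * \<kappa> * (norm v)\<^sup>2)"
proof -
  define h where "h = (\<lambda>s. grad f (x + s *\<^sub>R v) \<bullet> v + \<kappa> * (norm v)\<^sup>2 * s)"
  have "(h has_real_derivative blinfun_apply (hess f (x + s *\<^sub>R v)) v \<bullet> v + \<kappa> * (norm v)\<^sup>2) (at s)" for s
  proof -
    have "((\<lambda>s. grad f (x + s *\<^sub>R v)) has_derivative (\<lambda>t. blinfun_apply (hess f (x + s *\<^sub>R v)) (t *\<^sub>R v))) (at s)"
      by (rule has_derivative_compose[OF _ C2_fun_grad_has_derivative[OF f]])
        (auto intro!: derivative_eq_intros)
    then show ?thesis
      unfolding h_def has_field_derivative_def
      by (auto intro!: derivative_eq_intros simp: blinfun.scaleR_right algebra_simps)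
  qed
  moreover have "blinfun_apply (hess f (x + s *\<^sub>R v)) v \<bullet> v + \<kappa> * (norm v)\<^sup>2 \<ge> 0" for s
    using hess[where u = v and x = "x + s *\<^sub>R v"] by simp
  ultimately have "h 0 \<le> h \<beta>"
    using DERIV_nonneg_imp_nondecreasing[OF \<open>\<beta> \<ge> 0\<close>, of h] by blast
  then show ?thesis by (simp add: h_def inner_diff_left algebra_simps)
qed

text \<open>Mean value inequality on the segment for \<open>grad f\<close> minus its linearization
  at \<open>x\<close>: there the Hessian differs from \<open>hess f x\<close> by at most
  \<open>M * norm h\<close>. This gives the constant \<open>M\<close> instead of the sharper
  \<open>M / 2\<close>.\<close>

lemma grad_taylor_le:
  assumes f: "C2_fun f" and S: "convex S" "x \<in> S" "x + h \<in> S"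
    and M: "M-lipschitz_on S (hess f)"
  shows "norm (grad f (x + h) - grad f x - blinfun_apply (hess f x) h) \<le> M * (norm h)\<^sup>2"
proof -
  define C where "C = closed_segment x (x + h)"
  have CS: "C \<subseteq> S" unfolding C_def using S by (simp add: closed_segment_subset)
  have "norm (grad f (x + h) - grad f x - blinfun_apply (hess f x) (x + h - x))
      \<le> norm (x + h - x) * (M * norm h)"
  proof (rule differentiable_bound_linearization[where S = C and f' = "\<lambda>z. blinfun_apply (hess f z)"])
    show "x + t *\<^sub>R (x + h - x) \<in> C" if "t \<in> {0..1}" for t
      using that unfolding C_def in_segment by (auto simp: algebra_simps intro!: exI[of _ t])
    show "(grad f has_derivative blinfun_apply (hess f z)) (at z within C)" for z
      by (rule has_derivative_at_withinI[OF C2_fun_grad_has_derivative[OF f]])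
    show "onorm (blinfun_apply (hess f z) - blinfun_apply (hess f x)) \<le> M * norm h" if "z \<in> C" for z
    proof -
      have "onorm (blinfun_apply (hess f z) - blinfun_apply (hess f x)) = norm (hess f z - hess f x)"
        by (simp add: norm_blinfun.rep_eq minus_blinfun.rep_eq fun_diff_def)
      also have "\<dots> \<le> M * dist z x"
        using lipschitz_onD[OF M, of z x] that CS S(2) by (auto simp: dist_norm)
      also have "\<dots> \<le> M * norm h"
        using segment_bound(1)[of z x "x + h"] that lipschitz_on_nonneg[OF M]
        by (intro mult_left_mono) (auto simp: C_def dist_norm)
      finally show ?thesis .
    qed
    show "x \<in> C" by (simp add: C_def)
  qed
  then show ?thesis by (simp add: power2_eq_square algebra_simps)
qed

section \<open>Energy estimate for strong solutions\<close>

text \<open>Merges the almost everywhere conditions into a single negligible set and solves the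
  equation for the acceleration \<open>y\<close>. As \<open>x'\<close> equals \<open>v\<close>
  almost everywhere, \<open>v\<close> can replace it under the integral.\<close>

lemma strong_solution_weak_primitives:
  fixes F :: "'a::real_inner \<Rightarrow> 'a \<Rightarrow> 'a"
  assumes "strong_solution \<gamma> \<phi> F x\<^sub>0 v\<^sub>0 T x v"
  shows "weak_primitive T x v"
    and "\<exists>y \<xi> N. weak_primitive T v y \<and> L2_on T y \<and> negligible N \<and>
      (\<forall>t\<in>{0..T} - N. \<xi> t \<in> subdiff \<phi> (v t) \<and> y t = - (\<gamma> *\<^sub>R v t + \<xi> t + F (x t) (v t)))"
proof -
  obtain x' y \<xi> where x: "W12_deriv T x x'" and v: "W12_deriv T v y"
    and ae: "AE t in lebesgue_on {0..T}. v t = x' t"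
      "AE t in lebesgue_on {0..T}. \<xi> t \<in> subdiff \<phi> (v t)"
      "AE t in lebesgue_on {0..T}. y t + \<gamma> *\<^sub>R v t + \<xi> t + F (x t) (v t) = 0"
    using assms unfolding strong_solution_def by blast
  from ae have "AE t in lebesgue_on {0..T}. v t = x' t \<and> \<xi> t \<in> subdiff \<phi> (v t) \<and>
      y t + \<gamma> *\<^sub>R v t + \<xi> t + F (x t) (v t) = 0"
    by eventually_elim auto
  from AE_lebesgue_on_negligible[OF this] obtain N where N: "negligible N"
    and eq: "\<forall>t\<in>{0..T} - N. v t = x' t \<and> \<xi> t \<in> subdiff \<phi> (v t) \<and>
      y t + \<gamma> *\<^sub>R v t + \<xi> t + F (x t) (v t) = 0"
    by (elim exE conjE)
  have "weak_primitive T x x'" using x by (simp add: W12_deriv_def weak_primitive_def)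
  from weak_primitive_spike[OF this N] eq show "weak_primitive T x v" by auto
  have "weak_primitive T v y" "L2_on T y"
    using v by (auto simp: W12_deriv_def weak_primitive_def)
  moreover have "y t = - (\<gamma> *\<^sub>R v t + \<xi> t + F (x t) (v t))" if "t \<in> {0..T} - N" for t
    using bspec[OF eq that] by (metis (no_types, lifting) add.assoc eq_neg_iff_add_eq_0)
  ultimately show "\<exists>y \<xi> N. weak_primitive T v y \<and> L2_on T y \<and> negligible N \<and>
      (\<forall>t\<in>{0..T} - N. \<xi> t \<in> subdiff \<phi> (v t) \<and> y t = - (\<gamma> *\<^sub>R v t + \<xi> t + F (x t) (v t)))"
    using N eq by (rule_tac exI[of _ y], rule_tac exI[of _ \<xi>], rule_tac exI[of _ N]) auto
qed

lemma L2_on_norm_integrable_on: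
  assumes "L2_on T y"
  shows "(\<lambda>t. norm (y t)) integrable_on {0..T}" "(\<lambda>t. (norm (y t))\<^sup>2) integrable_on {0..T}"
  using integrable_on_power2_sum[of "\<lambda>t. norm (y t)" T "\<lambda>_. 0"] L2_on_norm_measurable[OF assms] assms
  by (auto simp: L2_on_def)

lemma weak_primitive_mono:
  "weak_primitive T u y \<Longrightarrow> t \<le> T \<Longrightarrow> weak_primitive t u y"
  by (auto simp: weak_primitive_def)

text \<open>The force enters only through the lower bound on
  \<open>(F x v - grad f x) \<bullet> v\<close>, so one lemma serves both systems. The resulting
  bound involves only the initial data and the lower bound \<open>m\<close> of
  \<open>f\<close>.\<close>

lemma energy_bound:
  fixes f :: "'a::real_inner \<Rightarrow> real"
  assumes f: "C2_fun f" and m: "\<And>x. m \<le> f x"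
    and \<phi>: "proper_fun \<phi>" "\<phi> 0 = 0" "\<And>v. \<phi> 0 \<le> \<phi> v"
    and F: "\<And>x v. (F x v - grad f x) \<bullet> v \<ge> - \<gamma> * (norm v)\<^sup>2"
    and sol: "strong_solution \<gamma> \<phi> F x\<^sub>0 v\<^sub>0 T x v" and t: "t \<in> {0..T}"
  shows "(norm (v t))\<^sup>2 \<le> (norm v\<^sub>0)\<^sup>2 + 2 * (f x\<^sub>0 - m)"
proof -
  note x = strong_solution_weak_primitives(1)[OF sol]
  obtain y \<xi> N where v: "weak_primitive T v y" and y: "L2_on T y" and N: "negligible N"
    and eq: "\<forall>t\<in>{0..T} - N. \<xi> t \<in> subdiff \<phi> (v t) \<and> y t = - (\<gamma> *\<^sub>R v t + \<xi> t + F (x t) (v t))"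
    using strong_solution_weak_primitives(2)[OF sol] by metis
  note p = L2_on_norm_integrable_on[OF y]
  have cont: "continuous_on {0..T} v"
    by (rule weak_primitive_continuous_on[OF v p(1)]) simp
  \<comment> \<open>Chain rule for \<open>f\<close> along \<open>x\<close>: continuity of
    \<open>v\<close> makes \<open>x\<close> differentiable at every time, not just almost
    everywhere.\<close>
  have "((\<lambda>\<tau>. grad f (x \<tau>) \<bullet> v \<tau>) has_integral f (x t) - f (x 0)) {0..t}"
  proof (rule fundamental_theorem_of_calculus)
    show "0 \<le> t" using t by simp
    fix \<tau> assume \<tau>: "\<tau> \<in> {0..t}"
    have "(x has_vector_derivative v \<tau>) (at \<tau> within {0..T})"
      using \<tau> t by (intro weak_primitive_has_vector_derivative[OF x cont]) auto
    then have "(x has_derivative (\<lambda>h. h *\<^sub>R v \<tau>)) (at \<tau> within {0..t})"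
      unfolding has_vector_derivative_def
      by (rule has_derivative_subset) (use t in auto)
    from has_derivative_compose[OF this C2_fun_gderiv[OF f, unfolded gderiv_def]]
    show "((\<lambda>\<tau>. f (x \<tau>)) has_vector_derivative grad f (x \<tau>) \<bullet> v \<tau>) (at \<tau> within {0..t})"
      by (simp add: has_vector_derivative_def inner_commute)
  qed
  then have q: "((\<lambda>\<tau>. - (grad f (x \<tau>) \<bullet> v \<tau>)) has_integral - (f (x t) - f (x 0))) {0..t}"
    by (rule has_integral_neg)
  have "(norm (v t))\<^sup>2 \<le> (norm (v 0))\<^sup>2 + 2 * integral {0..t} (\<lambda>\<tau>. - (grad f (x \<tau>) \<bullet> v \<tau>))"
  proof (rule norm_power2_weak_primitive_le[where p = "\<lambda>t. norm (y t)" and y = y])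
    show "weak_primitive t v y" using weak_primitive_mono[OF v] t by simp
    show "(\<lambda>t. norm (y t)) integrable_on {0..t}" "(\<lambda>t. (norm (y t))\<^sup>2) integrable_on {0..t}"
      using p t by (auto intro: integrable_on_subinterval)
    show "negligible N" by fact
    \<comment> \<open>The damping absorbs \<open>F x v - grad f x\<close>, and monotonicity against
      the subgradient 0 at the point 0 gives
      \<open>\<xi> \<tau> \<bullet> v \<tau> \<ge> 0\<close>.\<close>
    show "y \<tau> \<bullet> v \<tau> \<le> - (grad f (x \<tau>) \<bullet> v \<tau>)" if "\<tau> \<in> {0..t} - N" for \<tau>
    proof -
      have \<tau>: "\<tau> \<in> {0..T} - N" using that t by auto
      have "(\<xi> \<tau> - 0) \<bullet> (v \<tau> - 0) \<ge> 0"
        using bspec[OF eq \<tau>] subdiff_zero_of_min[of \<phi>, OF \<phi>(2,3)]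
        by (intro subdiff_monotone[OF \<phi>(1,2)]) auto
      then show ?thesis
        using F[where x = "x \<tau>" and v = "v \<tau>"] bspec[OF eq \<tau>]
        by (simp add: inner_diff_left inner_add_left power2_norm_eq_inner)
    qed
  qed (use t q in auto)
  then have "(norm (v t))\<^sup>2 \<le> (norm (v 0))\<^sup>2 + 2 * (f (x 0) - f (x t))"
    using integral_unique[OF q] by simp
  moreover have "x 0 = x\<^sub>0" "v 0 = v\<^sub>0" using sol by (auto simp: strong_solution_def)
  ultimately show ?thesis using m[of "x t"] by simp
qed

section \<open>Stability estimate and comparison of the forces\<close>

text \<open>Meant for \<open>z\<close> and \<open>w\<close> the differences of positions and
  velocities and \<open>c\<close> the defect between the forces. The bound is linear in
  \<open>c\<close>, so a defect of order \<open>\<beta>\<^sup>2\<close> gives an error of the same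
  order.\<close>

lemma second_order_gronwall:
  fixes z w y :: "real \<Rightarrow> 'a::real_inner"
  assumes z: "weak_primitive T z w" "z 0 = 0" and w: "weak_primitive T w y" "w 0 = 0"
    and p: "p integrable_on {0..T}" "(\<lambda>t. (p t)\<^sup>2) integrable_on {0..T}"
      "\<And>t. t \<in> {0..T} \<Longrightarrow> norm (y t) \<le> p t"
    and pos: "A \<ge> 0" "B \<ge> 0" "c \<ge> 0"
    and N: "negligible N"
    and le: "\<And>t. t \<in> {0..T} - N \<Longrightarrow> y t \<bullet> w t \<le> (A * norm (z t) + B * norm (w t) + c) * norm (w t)"
    and t: "t \<in> {0..T}"
  shows "norm (z t) + norm (w t) \<le> sqrt (2 * exp ((A + 2 * B + 2) * T)) * c"
proof -
  \<comment> \<open>The velocity contributes \<open>A + 2 * B + 1\<close>, where the 1 comes from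
    Young's inequality for the \<open>c\<close> term, and the position contributes another
    1.\<close>
  define K where "K = A + 2 * B + 2"
  have K: "K \<ge> 2" using pos by (simp add: K_def)
  define g where "g = (\<lambda>t. (norm (z t))\<^sup>2 + (norm (w t))\<^sup>2)"
  have contw: "continuous_on {0..T} w"
    by (rule weak_primitive_continuous_on[OF w(1) p(1,3)])
  have contz: "continuous_on {0..T} z"
    by (rule weak_primitive_continuous_on[OF z(1), of "\<lambda>t. norm (w t)"])
      (auto intro!: integrable_continuous_real continuous_intros contw)
  have contg: "continuous_on {0..T} g"
    unfolding g_def by (intro continuous_intros contw contz)
  have bound: "g s \<le> integral {0..s} (\<lambda>s. K * g s + c\<^sup>2)" if s: "s \<in> {0..T}" for s
  proof -
    have sub: "{0..s} \<subseteq> {0..T}" using s by auto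
    have gs: "continuous_on {0..s} g" and ws: "continuous_on {0..s} w"
      using sub contg contw by (auto intro: continuous_on_subset)
    have "(norm (w s))\<^sup>2 \<le> (norm (w 0))\<^sup>2 + 2 * integral {0..s} (\<lambda>s. (K - 1) / 2 * g s + c\<^sup>2 / 2)"
    proof (rule norm_power2_weak_primitive_le[where p = p and y = y and N = N])
      show "weak_primitive s w y" using weak_primitive_mono[OF w(1)] s by simp
      show "p integrable_on {0..s}" "(\<lambda>t. (p t)\<^sup>2) integrable_on {0..s}"
        using p(1,2) sub by (auto intro: integrable_on_subinterval)
      show "(\<lambda>s. (K - 1) / 2 * g s + c\<^sup>2 / 2) integrable_on {0..s}"
        by (intro integrable_continuous_real continuous_intros gs)
      fix \<tau> assume "\<tau> \<in> {0..s} - N"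
      then have "y \<tau> \<bullet> w \<tau> \<le> A * (norm (z \<tau>) * norm (w \<tau>)) + B * (norm (w \<tau>))\<^sup>2 + c * norm (w \<tau>)"
        using le[of \<tau>] sub by (auto simp: algebra_simps power2_eq_square)
      moreover have "A * (norm (z \<tau>) * norm (w \<tau>)) \<le> A * (g \<tau> / 2)"
        using sum_squares_bound[of "norm (z \<tau>)" "norm (w \<tau>)"] pos
        by (intro mult_left_mono) (auto simp: g_def)
      moreover have "B * (norm (w \<tau>))\<^sup>2 \<le> B * g \<tau>"
        using pos by (intro mult_left_mono) (auto simp: g_def)
      moreover have "c * norm (w \<tau>) \<le> c\<^sup>2 / 2 + g \<tau> / 2"
        using sum_squares_bound[of c "norm (w \<tau>)"] zero_le_power2[of "norm (z \<tau>)"]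
        unfolding g_def add_divide_distrib mult.assoc by linarith
      moreover have "(K - 1) / 2 * g \<tau> = A * (g \<tau> / 2) + B * g \<tau> + g \<tau> / 2"
        by (simp add: K_def algebra_simps add_divide_distrib)
      ultimately show "y \<tau> \<bullet> w \<tau> \<le> (K - 1) / 2 * g \<tau> + c\<^sup>2 / 2"
        by linarith
    qed (use s p N in auto)
    \<comment> \<open>The derivative of \<open>z\<close> is \<open>w\<close> itself, so the bound
      \<open>w \<bullet> z \<le> g / 2\<close> holds at all times and the exceptional set is
      empty.\<close>
    moreover have "(norm (z s))\<^sup>2 \<le> (norm (z 0))\<^sup>2 + 2 * integral {0..s} (\<lambda>s. g s / 2)"
    proof (rule norm_power2_weak_primitive_le[where p = "\<lambda>t. norm (w t)" and y = w and N = "{}"])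
      show "weak_primitive s z w" using weak_primitive_mono[OF z(1)] s by simp
      show "(\<lambda>t. norm (w t)) integrable_on {0..s}" "(\<lambda>t. (norm (w t))\<^sup>2) integrable_on {0..s}"
        "(\<lambda>s. g s / 2) integrable_on {0..s}"
        by (intro integrable_continuous_real continuous_intros gs ws; simp)+
      show "w \<tau> \<bullet> z \<tau> \<le> g \<tau> / 2" for \<tau>
        using norm_cauchy_schwarz[of "w \<tau>" "z \<tau>"] sum_squares_bound[of "norm (w \<tau>)" "norm (z \<tau>)"]
        by (simp add: g_def)
    qed (use s in auto)
    ultimately have "g s \<le> 2 * (integral {0..s} (\<lambda>s. (K - 1) / 2 * g s + c\<^sup>2 / 2) + integral {0..s} (\<lambda>s. g s / 2))"
      using z(2) w(2) by (simp add: g_def)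
    also have "integral {0..s} (\<lambda>s. (K - 1) / 2 * g s + c\<^sup>2 / 2) + integral {0..s} (\<lambda>s. g s / 2)
        = integral {0..s} (\<lambda>s. ((K - 1) / 2 * g s + c\<^sup>2 / 2) + g s / 2)"
      by (intro Henstock_Kurzweil_Integration.integral_add[symmetric] integrable_continuous_real
          continuous_intros gs) simp
    also have "2 * \<dots> = integral {0..s} (\<lambda>s. 2 * (((K - 1) / 2 * g s + c\<^sup>2 / 2) + g s / 2))"
      by (rule integral_mult_right[symmetric])
    also have "\<dots> = integral {0..s} (\<lambda>s. K * g s + c\<^sup>2)"
      by (rule arg_cong[where f = "integral {0..s}"]) (auto simp: field_simps)
    finally show ?thesis .
  qed
  have "g t \<le> c\<^sup>2 / K * exp (K * t)"
  proof (rule gronwall_affine)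
    show "continuous_on {0..t} g" using contg t by (auto intro: continuous_on_subset)
  qed (use K t bound in auto)
  also have "\<dots> \<le> c\<^sup>2 * exp (K * T)"
  proof (rule mult_mono)
    show "c\<^sup>2 / K \<le> c\<^sup>2"
      using K divide_left_mono[of 1 K "c\<^sup>2"] by simp
  qed (use K t in auto)
  finally have g: "2 * g t \<le> 2 * exp (K * T) * c\<^sup>2" by (simp add: mult.commute)
  \<comment> \<open>From \<open>(a + b)\<^sup>2 \<le> 2 * (a\<^sup>2 + b\<^sup>2)\<close>; this is
    the factor 2 under the root in the final constant.\<close>
  have "norm (z t) + norm (w t) \<le> sqrt (2 * g t)"
    using sum_squares_bound[of "norm (z t)" "norm (w t)"]
    by (intro real_le_rsqrt) (simp add: g_def power2_sum)
  also have "\<dots> \<le> sqrt (2 * exp (K * T) * c\<^sup>2)" using g by simp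
  also have "\<dots> = sqrt (2 * exp (K * T)) * c" using pos by (simp add: real_sqrt_mult)
  finally show ?thesis by (simp add: K_def)
qed

text \<open>Insert \<open>grad f (x' + \<beta> *\<^sub>R v')\<close>. The implicit force at the two
  states is compared by Lipschitz continuity; at the second state the explicit force is the
  first-order Taylor expansion of the implicit one.\<close>

lemma force_I_E_diff_le:
  fixes f :: "'a::real_inner \<Rightarrow> real"
  assumes f: "C2_fun f" and \<beta>: "0 \<le> \<beta>" "\<beta> \<le> b"
    and S: "convex S" "x + \<beta> *\<^sub>R v \<in> S" "x' \<in> S" "x' + \<beta> *\<^sub>R v' \<in> S"
    and L: "L-lipschitz_on S (grad f)" and M: "M-lipschitz_on S (hess f)"
    and V: "norm v' \<le> V"
  shows "norm (force_I f \<beta> x v - force_E f \<beta> x' v')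
    \<le> L * norm (x - x') + L * b * norm (v - v') + M * V\<^sup>2 * \<beta>\<^sup>2"
proof -
  have "norm (grad f (x + \<beta> *\<^sub>R v) - grad f (x' + \<beta> *\<^sub>R v'))
      \<le> L * norm ((x - x') + \<beta> *\<^sub>R (v - v'))"
    using lipschitz_onD[OF L S(2,4)] by (simp add: dist_norm algebra_simps)
  also have "\<dots> \<le> L * (norm (x - x') + b * norm (v - v'))"
    using norm_triangle_ineq[of "x - x'" "\<beta> *\<^sub>R (v - v')"] \<beta> lipschitz_on_nonneg[OF L]
      mult_right_mono[OF \<beta>(2), of "norm (v - v')"]
    by (intro mult_left_mono) auto
  finally have 1: "norm (grad f (x + \<beta> *\<^sub>R v) - grad f (x' + \<beta> *\<^sub>R v'))
      \<le> L * norm (x - x') + L * b * norm (v - v')" by (simp add: algebra_simps)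
  have "norm (grad f (x' + \<beta> *\<^sub>R v') - grad f x' - blinfun_apply (hess f x') (\<beta> *\<^sub>R v'))
      \<le> M * (norm (\<beta> *\<^sub>R v'))\<^sup>2"
    by (rule grad_taylor_le[OF f S(1,3,4) M])
  also have "\<dots> \<le> M * (V\<^sup>2 * \<beta>\<^sup>2)"
    using V \<beta> lipschitz_on_nonneg[OF M]
    by (intro mult_left_mono) (auto simp: power_mult_distrib mult.commute[of "V\<^sup>2"] intro!: mult_left_mono power_mono)
  finally have 2: "norm (grad f (x' + \<beta> *\<^sub>R v') - force_E f \<beta> x' v') \<le> M * V\<^sup>2 * \<beta>\<^sup>2"
    by (simp add: force_E_def blinfun.scaleR_right diff_diff_eq)
  show ?thesis
    using 1 2 norm_triangle_ineq[of "grad f (x + \<beta> *\<^sub>R v) - grad f (x' + \<beta> *\<^sub>R v')"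
        "grad f (x' + \<beta> *\<^sub>R v') - force_E f \<beta> x' v'"]
    by (simp add: force_I_def)
qed

lemma strong_solution_position_le:
  assumes sol: "strong_solution \<gamma> \<phi> F x\<^sub>0 v\<^sub>0 T x v"
    and V: "\<And>t. t \<in> {0..T} \<Longrightarrow> norm (v t) \<le> V" and t: "t \<in> {0..T}"
  shows "norm (x t) \<le> norm x\<^sub>0 + T * V"
proof -
  note x = strong_solution_weak_primitives(1)[OF sol]
  have "norm (x t - x 0 - (t - 0) *\<^sub>R 0) \<le> integral {0..t} (\<lambda>_. V)"
    using t V by (intro weak_primitive_increment_le[OF x]) auto
  then have "norm (x t - x\<^sub>0) \<le> t * V" using t sol by (simp add: strong_solution_def)
  also have "\<dots> \<le> T * V"
    using t V[OF t] by (intro mult_right_mono) (auto intro: order_trans[OF norm_ge_zero])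
  finally show ?thesis using norm_triangle_sub[of "x t" x\<^sub>0] by simp
qed

section \<open>Quadratic error bound, uniform in \<beta>\<close>

theorem theorem3p4:
  fixes f :: "'a::{real_inner, complete_space} \<Rightarrow> real"
    and \<phi> :: "'a \<Rightarrow> ereal"
    and x\<^sub>0 v\<^sub>0 :: 'a
    and \<gamma> \<kappa> r \<beta>bar :: real
  assumes "\<gamma> > 0"
    and "C2_fun f"
    and "bdd_below (range f)"
    and "lipschitz_on_bounded (grad f)"
    and "bounded_on_bounded (hess f)"
    and "lipschitz_on_bounded (hess f)"
    and "\<kappa> \<ge> 0"
    and "\<And>x u. blinfun_apply (hess f x) u \<bullet> u \<ge> - \<kappa> * (norm u)\<^sup>2"
    and "proper_fun \<phi>"
    and "lsc_fun \<phi>"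
    and "convex_fun \<phi>"
    and "\<phi> 0 = 0"
    and "\<And>v. \<phi> 0 \<le> \<phi> v"
    and "r > 0"
    and "cball 0 r \<subseteq> subdiff \<phi> 0"
    and "v\<^sub>0 \<in> Dom_subdiff \<phi>"
    and "\<beta>bar > 0"
    and "\<beta>bar * \<kappa> < \<gamma>"
  shows "\<forall>T>0. \<exists>C>0. \<forall>\<beta>\<in>{0..\<beta>bar}. \<forall>xI vI xE vE.
           global_strong_solution \<gamma> \<phi> (force_I f \<beta>) x\<^sub>0 v\<^sub>0 xI vI \<longrightarrow>
           global_strong_solution \<gamma> \<phi> (force_E f \<beta>) x\<^sub>0 v\<^sub>0 xE vE \<longrightarrow>
           (SUP t\<in>{0..T}. ereal (norm (xI t - xE t) + norm (vI t - vE t))) \<le> ereal (C * \<beta>\<^sup>2)"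
proof (intro allI impI)
  fix T :: real assume T: "T > 0"
  note f = assms(2) and hess = assms(8) and \<phi> = assms(9,12,13)
  obtain m where m: "\<And>x. m \<le> f x" using assms(3) by (auto simp: bdd_below_def)
  \<comment> \<open>The energy bound on the velocities of both systems.\<close>
  define V where "V = sqrt ((norm v\<^sub>0)\<^sup>2 + 2 * (f x\<^sub>0 - m))"
  \<comment> \<open>Positions have norm at most \<open>norm x\<^sub>0 + T * V\<close>; the extra
    \<open>\<beta>bar * V\<close> makes room for the shifted points
    \<open>x + \<beta> *\<^sub>R v\<close>. Thus \<open>L\<close> and \<open>M\<close> below do not
    depend on \<open>\<beta>\<close>.\<close>
  define S where "S = cball (0::'a) (norm x\<^sub>0 + T * V + \<beta>bar * V)"
  have V: "V \<ge> 0" using m[of x\<^sub>0] by (simp add: V_def)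
  obtain L M where L: "L-lipschitz_on S (grad f)" and M: "M-lipschitz_on S (hess f)"
    using assms(4,6) bounded_cball unfolding lipschitz_on_bounded_def S_def by metis
  have L0: "L \<ge> 0" and M0: "M \<ge> 0" using L M lipschitz_on_nonneg by auto
  \<comment> \<open>The constant of the stability estimate for \<open>A = L\<close>,
    \<open>B = L * \<beta>bar\<close> and \<open>c = M * V\<^sup>2 * \<beta>\<^sup>2\<close>, with
    \<open>\<beta>\<^sup>2\<close> split off.\<close>
  define D where "D = sqrt (2 * exp ((L + 2 * (L * \<beta>bar) + 2) * T)) * (M * V\<^sup>2)"
  have D: "D \<ge> 0" using M0 by (simp add: D_def)
  show "\<exists>C>0. \<forall>\<beta>\<in>{0..\<beta>bar}. \<forall>xI vI xE vE.
           global_strong_solution \<gamma> \<phi> (force_I f \<beta>) x\<^sub>0 v\<^sub>0 xI vI \<longrightarrow>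
           global_strong_solution \<gamma> \<phi> (force_E f \<beta>) x\<^sub>0 v\<^sub>0 xE vE \<longrightarrow>
           (SUP t\<in>{0..T}. ereal (norm (xI t - xE t) + norm (vI t - vE t))) \<le> ereal (C * \<beta>\<^sup>2)"
  proof (rule exI[of _ "D + 1"], intro conjI ballI allI impI)
    \<comment> \<open>\<open>D\<close> can vanish, for instance when \<open>V = 0\<close>; adding 1
      makes the constant positive.\<close>
    show "D + 1 > 0" using D by simp
    fix \<beta> xI vI xE vE
    assume \<beta>: "\<beta> \<in> {0..\<beta>bar}"
      and "global_strong_solution \<gamma> \<phi> (force_I f \<beta>) x\<^sub>0 v\<^sub>0 xI vI"
      and "global_strong_solution \<gamma> \<phi> (force_E f \<beta>) x\<^sub>0 v\<^sub>0 xE vE"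
    with T have solI: "strong_solution \<gamma> \<phi> (force_I f \<beta>) x\<^sub>0 v\<^sub>0 T xI vI"
      and solE: "strong_solution \<gamma> \<phi> (force_E f \<beta>) x\<^sub>0 v\<^sub>0 T xE vE"
      by (auto simp: global_strong_solution_def)
    have \<beta>\<kappa>: "\<beta> * \<kappa> \<le> \<gamma>"
      using \<beta> assms(7,18) mult_right_mono[of \<beta> \<beta>bar \<kappa>] by auto
    have dissipation: "- (\<beta> * \<kappa> * (norm v)\<^sup>2) \<ge> - \<gamma> * (norm v)\<^sup>2" for v :: 'a
      using mult_right_mono[OF \<beta>\<kappa>, of "(norm v)\<^sup>2"] by simp
    have "(force_I f \<beta> x v - grad f x) \<bullet> v \<ge> - \<gamma> * (norm v)\<^sup>2" for x v
      using grad_increment_inner_ge[OF f _ hess, where \<beta> = \<beta> and x = x and v = v] \<beta> dissipation[of v]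
      by (simp add: force_I_def)
    then have VI: "norm (vI t) \<le> V" if "t \<in> {0..T}" for t
      unfolding V_def by (intro real_le_rsqrt energy_bound[OF f m \<phi> _ solI that])
    have "(force_E f \<beta> x v - grad f x) \<bullet> v \<ge> - \<gamma> * (norm v)\<^sup>2" for x v
      using mult_left_mono[OF hess[where x = x and u = v], of \<beta>] \<beta> dissipation[of v]
      by (simp add: force_E_def mult.assoc)
    then have VE: "norm (vE t) \<le> V" if "t \<in> {0..T}" for t
      unfolding V_def by (intro real_le_rsqrt energy_bound[OF f m \<phi> _ solE that])
    have inS: "x \<in> S \<and> x + \<beta> *\<^sub>R v \<in> S" if "norm x \<le> norm x\<^sub>0 + T * V" "norm v \<le> V" for x v
    proof -
      have "norm (\<beta> *\<^sub>R v) \<le> \<beta>bar * V" using \<beta> that V by (simp add: mult_mono)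
      then show ?thesis
        using that norm_triangle_ineq[of x "\<beta> *\<^sub>R v"] norm_ge_zero[of "\<beta> *\<^sub>R v"]
        unfolding S_def mem_cball_0 by linarith
    qed
    obtain yI \<xi>I NI where I: "weak_primitive T vI yI" "L2_on T yI" "negligible NI"
      "\<forall>t\<in>{0..T} - NI. \<xi>I t \<in> subdiff \<phi> (vI t) \<and>
        yI t = - (\<gamma> *\<^sub>R vI t + \<xi>I t + force_I f \<beta> (xI t) (vI t))"
      using strong_solution_weak_primitives(2)[OF solI] by metis
    obtain yE \<xi>E NE where E: "weak_primitive T vE yE" "L2_on T yE" "negligible NE"
      "\<forall>t\<in>{0..T} - NE. \<xi>E t \<in> subdiff \<phi> (vE t) \<and>
        yE t = - (\<gamma> *\<^sub>R vE t + \<xi>E t + force_E f \<beta> (xE t) (vE t))"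
      using strong_solution_weak_primitives(2)[OF solE] by metis
    have init: "xI 0 = xE 0" "vI 0 = vE 0" using solI solE by (auto simp: strong_solution_def)
    show "(SUP t\<in>{0..T}. ereal (norm (xI t - xE t) + norm (vI t - vE t))) \<le> ereal ((D + 1) * \<beta>\<^sup>2)"
    proof (rule SUP_least)
      fix t assume t: "t \<in> {0..T}"
      have "norm (xI t - xE t) + norm (vI t - vE t)
          \<le> sqrt (2 * exp ((L + 2 * (L * \<beta>bar) + 2) * T)) * (M * V\<^sup>2 * \<beta>\<^sup>2)"
      proof (rule second_order_gronwall[OF weak_primitive_diff[OF strong_solution_weak_primitives(1)[OF solI]
                strong_solution_weak_primitives(1)[OF solE]] _ weak_primitive_diff[OF I(1) E(1)], where N = "NI \<union> NE" and
            p = "\<lambda>t. norm (yI t) + norm (yE t)"])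
        \<comment> \<open>The sum of the norms dominates \<open>norm (yI t - yE t)\<close>.\<close>
        show "(\<lambda>t. norm (yI t) + norm (yE t)) integrable_on {0..T}"
          "(\<lambda>t. (norm (yI t) + norm (yE t))\<^sup>2) integrable_on {0..T}"
          using I(2) E(2) by (auto intro!: integrable_on_power2_sum L2_on_norm_measurable simp: L2_on_def)
        fix \<tau> assume \<tau>: "\<tau> \<in> {0..T} - (NI \<union> NE)"
        let ?w = "vI \<tau> - vE \<tau>" and ?F = "force_I f \<beta> (xI \<tau>) (vI \<tau>) - force_E f \<beta> (xE \<tau>) (vE \<tau>)"
        have "(\<xi>I \<tau> - \<xi>E \<tau>) \<bullet> ?w \<ge> 0"
          using \<tau> by (intro subdiff_monotone[OF \<phi>(1,2)]) (use I(4) E(4) in auto)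
        moreover have "yI \<tau> - yE \<tau> = - (\<gamma> *\<^sub>R ?w + (\<xi>I \<tau> - \<xi>E \<tau>) + ?F)"
        proof -
          have y: "yI \<tau> = - (\<gamma> *\<^sub>R vI \<tau> + \<xi>I \<tau> + force_I f \<beta> (xI \<tau>) (vI \<tau>))"
            "yE \<tau> = - (\<gamma> *\<^sub>R vE \<tau> + \<xi>E \<tau> + force_E f \<beta> (xE \<tau>) (vE \<tau>))"
            using I(4) E(4) \<tau> by auto
          show ?thesis unfolding y by (simp add: algebra_simps)
        qed
        moreover have "\<gamma> * (?w \<bullet> ?w) \<ge> 0" using assms(1) by simp
        moreover have "- (?F \<bullet> ?w) \<le> norm ?F * norm ?w"
          using norm_cauchy_schwarz[of "- ?F" ?w] by (simp only: inner_minus_left norm_minus_cancel)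
        \<comment> \<open>The subgradient and damping terms contribute nonpositively, so only the
          force difference remains.\<close>
        ultimately have "(yI \<tau> - yE \<tau>) \<bullet> ?w \<le> norm ?F * norm ?w"
          by (simp only: inner_minus_left inner_add_left inner_scaleR_left)
        also have "norm ?F \<le> L * norm (xI \<tau> - xE \<tau>) + L * \<beta>bar * norm ?w + M * V\<^sup>2 * \<beta>\<^sup>2"
          using \<tau> \<beta> VI[of \<tau>] VE[of \<tau>] inS[of "xI \<tau>" "vI \<tau>"] inS[of "xE \<tau>" "vE \<tau>"]
            strong_solution_position_le[OF solI VI, of \<tau>] strong_solution_position_le[OF solE VE, of \<tau>]
          by (intro force_I_E_diff_le[OF f _ _ _ _ _ _ L M]) (auto simp: S_def)
        finally show "(yI \<tau> - yE \<tau>) \<bullet> ?w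
            \<le> (L * norm (xI \<tau> - xE \<tau>) + L * \<beta>bar * norm ?w + M * V\<^sup>2 * \<beta>\<^sup>2) * norm ?w"
          by (simp add: mult_right_mono)
      qed (use init I(3) E(3) L0 M0 assms(17) t in \<open>auto intro: norm_triangle_ineq4\<close>)
      also have "\<dots> = D * \<beta>\<^sup>2" by (simp add: D_def)
      also have "\<dots> \<le> (D + 1) * \<beta>\<^sup>2" by (intro mult_right_mono) auto
      finally show "ereal (norm (xI t - xE t) + norm (vI t - vE t)) \<le> ereal ((D + 1) * \<beta>\<^sup>2)"
        by simp
    qed
  qed
qed

end
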